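(* Let $m\ge 1$ be an integer. If $h$ is an accelerator of $NEU_m$, then the iteration function $$h_k=\underbrace{h\circ h\circ\cdots\circ h}_{k\ \text{times}}$$ is at least a $k$-accelerator of $NEU_m$ for $k<m$.
   Context: $NEU_m$ is the set of real iteration functions $u$ that are defined and $m$ times continuously differentiable in a neighbourhood of an isolated fixed point $x^*$, with $u(x^* )=x^*$ and $u'(x^* )=1$. An accelerator of $u$ is an (explicitly constructed, possibly depending on $u$) iteration function $h$ having the same fixed point $x^*$ as $u$ and satisfying $h'(x^* )=0$. An accelerator of a set of iteration functions is an iteration map $h$ (a construction depending on $u$) which accelerates every $u$ in that set. An accelerator $h$ of $u$ is a $k$-accelerator of $u$ if $h'(x^* )=h^{(2)}(x^* )=\dots=h^{(k)}(x^* )=0$ and $h^{(k+1)}(x^* )\neq 0$. "At least a $k$-accelerator" means that the derivatives of orders $1,\dots,k$ vanish at $x^*$, with no condition on higher-order derivatives; "of $NEU_m$" means that this holds for each $u\in NEU_m$. Here $k$ is a positive integer.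
   Formalization: The formal statement additionally assumes that for each u in NEU_m the iteration function h is m−1 times differentiable at x*; without this the claim fails, e.g. h(t)=x*+|t−x*|^√2 with m=3, k=2, where h∘h has second derivative 2 at x*. *)

theory Defs
  imports "HOL-Analysis.Analysis"
begin

(* An iteration function is defined only near its fixed point; it is modelled by a total
   function, and every condition below is local at the point x. *)

definition times_cont_differentiable_near :: "nat \<Rightarrow> (real \<Rightarrow> real) \<Rightarrow> real \<Rightarrow> bool" where
  "times_cont_differentiable_near m f x \<longleftrightarrow>
     (\<exists>S. open S \<and> x \<in> S \<and>
          (\<forall>j<m. \<forall>y\<in>S. (deriv ^^ j) f differentiable (at y)) \<and>
          continuous_on S ((deriv ^^ m) f))"

(* Pointwise m-fold differentiability: the derivatives of order < m exist on a neighbourhood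
   of x, and the one of order m - 1 is differentiable at x itself.  Since deriv is total,
   equations between derivatives are only meaningful together with this predicate. *)
definition times_differentiable_at :: "nat \<Rightarrow> (real \<Rightarrow> real) \<Rightarrow> real \<Rightarrow> bool" where
  "times_differentiable_at m f x \<longleftrightarrow>
     (\<forall>j<m. (deriv ^^ j) f differentiable (at x)) \<and>
     (\<forall>j. Suc j < m \<longrightarrow> (\<forall>\<^sub>F y in nhds x. (deriv ^^ j) f differentiable (at y)))"

definition NEU :: "nat \<Rightarrow> real \<Rightarrow> (real \<Rightarrow> real) set" where
  "NEU m x = {u. x isolated_in {y. u y = y} \<and>
                 times_cont_differentiable_near m u x \<and>
                 (u has_real_derivative 1) (at x)}"

definition accelerator :: "real \<Rightarrow> (real \<Rightarrow> real) \<Rightarrow> (real \<Rightarrow> real) \<Rightarrow> bool" where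
  "accelerator x u h \<longleftrightarrow> u x = x \<and> h x = x \<and> (h has_real_derivative 0) (at x)"

definition at_least_k_accelerator :: "nat \<Rightarrow> real \<Rightarrow> (real \<Rightarrow> real) \<Rightarrow> (real \<Rightarrow> real) \<Rightarrow> bool" where
  "at_least_k_accelerator k x u h \<longleftrightarrow>
     u x = x \<and> h x = x \<and>
     times_differentiable_at k h x \<and> (\<forall>j\<in>{1..k}. (deriv ^^ j) h x = 0)"

(* An iteration map H sends each iteration function u to the iteration function H u. *)

definition accelerator_of_set ::
  "real \<Rightarrow> (real \<Rightarrow> real) set \<Rightarrow> ((real \<Rightarrow> real) \<Rightarrow> (real \<Rightarrow> real)) \<Rightarrow> bool" where
  "accelerator_of_set x U H \<longleftrightarrow> (\<forall>u\<in>U. accelerator x u (H u))"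

definition at_least_k_accelerator_of_set ::
  "nat \<Rightarrow> real \<Rightarrow> (real \<Rightarrow> real) set \<Rightarrow> ((real \<Rightarrow> real) \<Rightarrow> (real \<Rightarrow> real)) \<Rightarrow> bool" where
  "at_least_k_accelerator_of_set k x U H \<longleftrightarrow> (\<forall>u\<in>U. at_least_k_accelerator k x u (H u))"

end

theory Submission
  imports Defs
begin

text \<open>
  If \<open>g\<close> is the \<open>i\<close>-th iterate of \<open>f\<close>, then \<open>(f \<circ> g)' = (f' \<circ> g) \<cdot> g'\<close> near the fixed
  point.  The first factor vanishes there and the second vanishes to order \<open>i\<close>, so the product
  vanishes to order \<open>i + 1\<close>.  Only first-order product and chain rules are needed: induction on
  the order of differentiation replaces the formulas of Leibniz and Faa di Bruno.
\<close>

section \<open>Pointwise differentiability of order \<open>n\<close>: recursion and locality\<close>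

lemma times_differentiable_at_0 [simp]: "times_differentiable_at 0 f x"
  by (simp add: times_differentiable_at_def)

text \<open>Peels off the innermost derivative, so that inductions with \<open>f\<close> arbitrary
  can pass to \<open>deriv f\<close>. The guard \<open>0 < n\<close> reflects that the topmost
  derivative has to exist at \<open>x\<close> only.\<close>

lemma times_differentiable_at_Suc:
  "times_differentiable_at (Suc n) f x \<longleftrightarrow>
     f differentiable (at x) \<and> (0 < n \<longrightarrow> (\<forall>\<^sub>F y in nhds x. f differentiable (at y))) \<and>
     times_differentiable_at n (deriv f) x"
proof -
  have "(\<forall>j<Suc n. (deriv ^^ j) f differentiable (at x)) \<longleftrightarrow>
          f differentiable (at x) \<and> (\<forall>j<n. (deriv ^^ j) (deriv f) differentiable (at x))"
    unfolding All_less_Suc2 funpow_Suc_right by simp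
  moreover have "(\<forall>j. Suc j < Suc n \<longrightarrow> (\<forall>\<^sub>F y in nhds x. (deriv ^^ j) f differentiable (at y)))
     \<longleftrightarrow> (0 < n \<longrightarrow> (\<forall>\<^sub>F y in nhds x. f differentiable (at y))) \<and>
       (\<forall>j. Suc j < n \<longrightarrow> (\<forall>\<^sub>F y in nhds x. (deriv ^^ j) (deriv f) differentiable (at y)))"
    (is "(\<forall>j. _ \<longrightarrow> ?P j) \<longleftrightarrow> _")
  proof (cases n)
    case (Suc n')
    have "(\<forall>j<Suc n'. ?P j) \<longleftrightarrow> ?P 0 \<and> (\<forall>j<n'. ?P (Suc j))"
      by (rule All_less_Suc2)
    then show ?thesis
      unfolding Suc funpow_Suc_right by simp
  qed simp
  ultimately show ?thesis
    unfolding times_differentiable_at_def by blast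
qed

lemma times_differentiable_at_mono:
  "times_differentiable_at n f x \<Longrightarrow> m \<le> n \<Longrightarrow> times_differentiable_at m f x"
  unfolding times_differentiable_at_def by auto

text \<open>An equality near \<open>x\<close> is also an equality near every \<open>y\<close> close
  to \<open>x\<close>, so the derivatives agree at each such \<open>y\<close>.\<close>

lemma eventually_deriv_cong:
  fixes f g :: "real \<Rightarrow> real"
  assumes "\<forall>\<^sub>F y in nhds x. f y = g y"
  shows "\<forall>\<^sub>F y in nhds x. deriv f y = deriv g y"
  using eventually_eventually[THEN iffD2, OF assms]
  by eventually_elim (rule deriv_cong_ev, auto)

lemma differentiable_cong_nhds:
  fixes f g :: "real \<Rightarrow> real"
  assumes "\<forall>\<^sub>F y in nhds x. f y = g y" "f differentiable (at x)"
  shows "g differentiable (at x)"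
  using assms DERIV_cong_ev[OF refl assms(1) refl] by (auto simp: real_differentiable_def)

text \<open>The product and chain rules identify \<open>deriv\<close> of a compound function only
  near \<open>x\<close>; this lemma makes such local identities usable.\<close>

lemma times_differentiable_at_cong:
  assumes "\<forall>\<^sub>F y in nhds x. f y = g y" "times_differentiable_at n f x"
  shows "times_differentiable_at n g x"
  using assms
proof (induction n arbitrary: f g)
  case (Suc n)
  have "\<forall>\<^sub>F y in nhds x. g differentiable (at y)" if "0 < n"
  proof -
    have "\<forall>\<^sub>F y in nhds x. f differentiable (at y)"
      using Suc.prems(2) that by (simp add: times_differentiable_at_Suc)
    with eventually_eventually[THEN iffD2, OF Suc.prems(1)] show ?thesis
      by eventually_elim (rule differentiable_cong_nhds)
  qed
  with Suc show ?case
    by (auto simp: times_differentiable_at_Suc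
        intro: differentiable_cong_nhds eventually_deriv_cong)
qed simp

section \<open>Closure under sums, products and composition\<close>

lemma deriv_add_real:
  fixes f g :: "real \<Rightarrow> real"
  assumes "f differentiable (at y)" "g differentiable (at y)"
  shows "deriv (\<lambda>z. f z + g z) y = deriv f y + deriv g y"
  using assms by (intro DERIV_imp_deriv DERIV_add) (simp_all add: DERIV_deriv_iff_real_differentiable)

lemma deriv_mult_real:
  fixes f g :: "real \<Rightarrow> real"
  assumes "f differentiable (at y)" "g differentiable (at y)"
  shows "deriv (\<lambda>z. f z * g z) y = deriv f y * g y + f y * deriv g y"
  using DERIV_mult'[of f "deriv f y" y UNIV g "deriv g y"] assms
  by (intro DERIV_imp_deriv) (simp add: DERIV_deriv_iff_real_differentiable algebra_simps)

lemma deriv_comp_real: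
  fixes f g :: "real \<Rightarrow> real"
  assumes "f differentiable (at (g y))" "g differentiable (at y)"
  shows "deriv (\<lambda>z. f (g z)) y = deriv f (g y) * deriv g y"
  using assms
  by (intro DERIV_imp_deriv DERIV_chain2) (auto simp: DERIV_deriv_iff_real_differentiable)

lemma differentiable_comp_real:
  fixes f g :: "real \<Rightarrow> real"
  assumes "f differentiable (at (g y))" "g differentiable (at y)"
  shows "(\<lambda>z. f (g z)) differentiable (at y)"
  using differentiable_chain_at[OF assms(2,1)] by (simp add: o_def)

lemma times_differentiable_at_add:
  assumes "times_differentiable_at n f x" "times_differentiable_at n g x"
  shows "times_differentiable_at n (\<lambda>y. f y + g y) x"
  using assms
proof (induction n arbitrary: f g)
  case (Suc n)
  have at: "(\<lambda>y. f y + g y) differentiable (at x)"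
    using Suc.prems by (auto simp: times_differentiable_at_Suc)
  show ?case
  proof (cases "n = 0")
    \<comment> \<open>For \<open>n = 0\<close> differentiability is known, and asked, at
      \<open>x\<close> alone. For positive \<open>n\<close> it holds on a neighbourhood, so the sum
      rule is an identity of germs.\<close>
    case False
    with Suc.prems have "\<forall>\<^sub>F y in nhds x. f differentiable (at y)"
      "\<forall>\<^sub>F y in nhds x. g differentiable (at y)"
      by (auto simp: times_differentiable_at_Suc)
    then have near: "\<forall>\<^sub>F y in nhds x. (\<lambda>y. f y + g y) differentiable (at y)"
      and eq: "\<forall>\<^sub>F y in nhds x. deriv f y + deriv g y = deriv (\<lambda>y. f y + g y) y"
      by (eventually_elim, simp add: deriv_add_real)+
    have "times_differentiable_at n (\<lambda>y. deriv f y + deriv g y) x"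
      using Suc by (simp add: times_differentiable_at_Suc)
    from times_differentiable_at_cong[OF eq this] at near show ?thesis
      by (simp add: times_differentiable_at_Suc)
  qed (use at in \<open>simp add: times_differentiable_at_Suc\<close>)
qed simp

text \<open>Both terms of the product rule are again products, of one derivative and one original
  factor. The original factor is weakened to order \<open>n\<close> so that the induction hypothesis
  applies to each.\<close>

lemma times_differentiable_at_mult:
  assumes "times_differentiable_at n f x" "times_differentiable_at n g x"
  shows "times_differentiable_at n (\<lambda>y. f y * g y) x"
  using assms
proof (induction n arbitrary: f g)
  case (Suc n)
  have at: "(\<lambda>y. f y * g y) differentiable (at x)"
    using Suc.prems by (auto simp: times_differentiable_at_Suc)
  show ?case
  proof (cases "n = 0")
    case False
    with Suc.prems have "\<forall>\<^sub>F y in nhds x. f differentiable (at y)"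
      "\<forall>\<^sub>F y in nhds x. g differentiable (at y)"
      by (auto simp: times_differentiable_at_Suc)
    then have near: "\<forall>\<^sub>F y in nhds x. (\<lambda>y. f y * g y) differentiable (at y)"
      and eq: "\<forall>\<^sub>F y in nhds x. deriv f y * g y + f y * deriv g y = deriv (\<lambda>y. f y * g y) y"
      by (eventually_elim, simp add: deriv_mult_real)+
    have "times_differentiable_at n f x" "times_differentiable_at n g x"
      using Suc.prems by (auto elim: times_differentiable_at_mono)
    then have "times_differentiable_at n (\<lambda>y. deriv f y * g y + f y * deriv g y) x"
      using Suc by (intro times_differentiable_at_add) (simp_all add: times_differentiable_at_Suc)
    from times_differentiable_at_cong[OF eq this] at near show ?thesis
      by (simp add: times_differentiable_at_Suc)
  qed (use at in \<open>simp add: times_differentiable_at_Suc\<close>)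
qed simp

text \<open>Continuity of \<open>g\<close> at \<open>x\<close> pulls a neighbourhood of
  \<open>g x\<close> back to one of \<open>x\<close>.\<close>

lemma eventually_differentiable_comp:
  fixes f g :: "real \<Rightarrow> real"
  assumes "\<forall>\<^sub>F y in nhds (g x). f differentiable (at y)" "g differentiable (at x)"
  shows "\<forall>\<^sub>F y in nhds x. f differentiable (at (g y))"
proof -
  have "isCont g x"
    using assms(2) by (rule differentiable_imp_continuous_within)
  then have "filterlim g (nhds (g x)) (nhds x)"
    by (simp add: continuous_at_imp_continuous_within isCont_def tendsto_at_iff_tendsto_nhds)
  with assms(1) show ?thesis
    by (rule eventually_compose_filterlim)
qed

lemma times_differentiable_at_comp:
  assumes "times_differentiable_at n f (g x)" "times_differentiable_at n g x"
  shows "times_differentiable_at n (\<lambda>y. f (g y)) x"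
  using assms
proof (induction n arbitrary: f)
  case (Suc n)
  have at: "(\<lambda>y. f (g y)) differentiable (at x)"
    using Suc.prems by (auto simp: times_differentiable_at_Suc intro: differentiable_comp_real)
  show ?case
  proof (cases "n = 0")
    case False
    with Suc.prems have g: "\<forall>\<^sub>F y in nhds x. g differentiable (at y)"
      and f: "\<forall>\<^sub>F y in nhds x. f differentiable (at (g y))"
      by (auto simp: times_differentiable_at_Suc intro!: eventually_differentiable_comp)
    from f g have near: "\<forall>\<^sub>F y in nhds x. (\<lambda>y. f (g y)) differentiable (at y)"
      and eq: "\<forall>\<^sub>F y in nhds x. deriv f (g y) * deriv g y = deriv (\<lambda>y. f (g y)) y"
      by (eventually_elim, simp add: deriv_comp_real differentiable_comp_real)+
    have "times_differentiable_at n g x"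
      using Suc.prems by (auto elim: times_differentiable_at_mono)
    then have "times_differentiable_at n (\<lambda>y. deriv f (g y) * deriv g y) x"
      using Suc by (intro times_differentiable_at_mult) (simp_all add: times_differentiable_at_Suc)
    from times_differentiable_at_cong[OF eq this] at near show ?thesis
      by (simp add: times_differentiable_at_Suc)
  qed (use at in \<open>simp add: times_differentiable_at_Suc\<close>)
qed simp

section \<open>Order of vanishing, where order \<open>n\<close> means \<open>n\<close> conditions,
  the value itself included\<close>

definition vanishes_to_order :: "nat \<Rightarrow> (real \<Rightarrow> real) \<Rightarrow> real \<Rightarrow> bool" where
  "vanishes_to_order n f x \<longleftrightarrow> (\<forall>j<n. (deriv ^^ j) f x = 0)"

lemma vanishes_to_order_0 [simp]: "vanishes_to_order 0 f x"
  by (simp add: vanishes_to_order_def)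

lemma vanishes_to_order_Suc:
  "vanishes_to_order (Suc n) f x \<longleftrightarrow> f x = 0 \<and> vanishes_to_order n (deriv f) x"
  unfolding vanishes_to_order_def All_less_Suc2 funpow_Suc_right by simp

lemma vanishes_to_order_deriv:
  "vanishes_to_order n f x \<Longrightarrow> vanishes_to_order (n - 1) (deriv f) x"
  by (cases n) (simp_all add: vanishes_to_order_Suc)

lemma vanishes_to_order_cong:
  assumes "\<forall>\<^sub>F y in nhds x. f y = g y" "vanishes_to_order n f x"
  shows "vanishes_to_order n g x"
  using assms
proof (induction n arbitrary: f g)
  case (Suc n)
  then show ?case
    by (auto simp: vanishes_to_order_Suc eventually_nhds_x_imp_x intro: eventually_deriv_cong
        dest: eventually_nhds_x_imp_x)
qed simp

text \<open>
  The differentiability order is one less than the order of vanishing: the last derivative that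
  is evaluated has to exist at \<open>x\<close>, but nothing is required beyond it.
\<close>

lemma vanishes_to_order_add:
  assumes "times_differentiable_at n f x" "times_differentiable_at n g x"
    and "vanishes_to_order (Suc n) f x" "vanishes_to_order (Suc n) g x"
  shows "vanishes_to_order (Suc n) (\<lambda>y. f y + g y) x"
  using assms
proof (induction n arbitrary: f g)
  case (Suc n)
  have deriv_vanishes: "vanishes_to_order (Suc n) (\<lambda>y. deriv f y + deriv g y) x"
    using Suc by (simp add: times_differentiable_at_Suc vanishes_to_order_Suc)
  have "vanishes_to_order (Suc n) (deriv (\<lambda>y. f y + g y)) x"
  proof (cases "n = 0")
    \<comment> \<open>Only the value of the derivative at \<open>x\<close> is claimed here, so the
      sum rule at that point suffices.\<close>
    case True
    with Suc.prems deriv_vanishes show ?thesis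
      by (simp add: vanishes_to_order_Suc times_differentiable_at_Suc deriv_add_real)
  next
    case False
    with Suc.prems have "\<forall>\<^sub>F y in nhds x. f differentiable (at y)"
      "\<forall>\<^sub>F y in nhds x. g differentiable (at y)"
      by (auto simp: times_differentiable_at_Suc)
    then have "\<forall>\<^sub>F y in nhds x. deriv f y + deriv g y = deriv (\<lambda>y. f y + g y) y"
      by eventually_elim (simp add: deriv_add_real)
    then show ?thesis
      using deriv_vanishes by (rule vanishes_to_order_cong)
  qed
  then show ?case
    using Suc.prems by (simp add: vanishes_to_order_Suc)
qed (simp add: vanishes_to_order_Suc)

text \<open>Orders of vanishing add up. Differentiating lowers the order of one factor by at most
  one, which keeps \<open>n < a + b\<close> intact as \<open>n\<close> drops by one too.\<close>

lemma vanishes_to_order_mult: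
  assumes "times_differentiable_at n f x" "times_differentiable_at n g x"
    and "vanishes_to_order a f x" "vanishes_to_order b g x" "n < a + b"
  shows "vanishes_to_order (Suc n) (\<lambda>y. f y * g y) x"
  using assms
proof (induction n arbitrary: f g a b)
  case 0
  then show ?case
    by (cases a; cases b) (auto simp: vanishes_to_order_Suc)
next
  case (Suc n)
  \<comment> \<open>The bound on \<open>a + b\<close> makes \<open>a\<close> or \<open>b\<close>
    positive, so one factor is zero at \<open>x\<close>.\<close>
  have prod_zero: "f x * g x = 0"
    using Suc.prems(3-5) by (cases a; cases b) (auto simp: vanishes_to_order_Suc)
  have d: "times_differentiable_at n f x" "times_differentiable_at n g x"
    "times_differentiable_at n (deriv f) x" "times_differentiable_at n (deriv g) x"
    using Suc.prems(1,2) times_differentiable_at_mono[of "Suc n" _ x n]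
    by (auto simp: times_differentiable_at_Suc)
  \<comment> \<open>Subtraction is truncated: if \<open>a = 0\<close>, nothing is lost and
    \<open>b\<close> alone carries the bound.\<close>
  have "vanishes_to_order (Suc n) (\<lambda>y. deriv f y * g y) x"
    using Suc.prems d by (intro Suc.IH[of _ _ "a - 1" b] vanishes_to_order_deriv) auto
  moreover have "vanishes_to_order (Suc n) (\<lambda>y. f y * deriv g y) x"
    using Suc.prems d by (intro Suc.IH[of _ _ a "b - 1"] vanishes_to_order_deriv) auto
  ultimately have deriv_vanishes:
    "vanishes_to_order (Suc n) (\<lambda>y. deriv f y * g y + f y * deriv g y) x"
    using d by (intro vanishes_to_order_add times_differentiable_at_mult)
  have "vanishes_to_order (Suc n) (deriv (\<lambda>y. f y * g y)) x"
  proof (cases "n = 0")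
    case True
    with Suc.prems deriv_vanishes show ?thesis
      by (simp add: vanishes_to_order_Suc times_differentiable_at_Suc deriv_mult_real)
  next
    case False
    with Suc.prems have "\<forall>\<^sub>F y in nhds x. f differentiable (at y)"
      "\<forall>\<^sub>F y in nhds x. g differentiable (at y)"
      by (auto simp: times_differentiable_at_Suc)
    then have "\<forall>\<^sub>F y in nhds x. deriv f y * g y + f y * deriv g y = deriv (\<lambda>y. f y * g y) y"
      by eventually_elim (simp add: deriv_mult_real)
    then show ?thesis
      using deriv_vanishes by (rule vanishes_to_order_cong)
  qed
  then show ?case
    using prod_zero by (simp add: vanishes_to_order_Suc)
qed

text \<open>The factors \<open>deriv f\<close> after \<open>g\<close> and \<open>deriv g\<close>
  vanish to orders 1 and \<open>n\<close>, and \<open>n < 1 + n\<close> is just what the product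
  lemma demands.\<close>

lemma vanishes_to_order_deriv_comp:
  assumes "times_differentiable_at (Suc n) f (g x)" "times_differentiable_at (Suc n) g x"
    and "deriv f (g x) = 0" "vanishes_to_order n (deriv g) x"
  shows "vanishes_to_order (Suc n) (deriv (\<lambda>y. f (g y))) x"
proof (cases "n = 0")
  case True
  with assms show ?thesis
    by (simp add: vanishes_to_order_Suc times_differentiable_at_Suc deriv_comp_real)
next
  case False
  with assms have "\<forall>\<^sub>F y in nhds x. f differentiable (at (g y))"
    "\<forall>\<^sub>F y in nhds x. g differentiable (at y)"
    by (auto simp: times_differentiable_at_Suc intro!: eventually_differentiable_comp)
  then have eq: "\<forall>\<^sub>F y in nhds x. deriv f (g y) * deriv g y = deriv (\<lambda>y. f (g y)) y"
    by eventually_elim (simp add: deriv_comp_real)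
  have "times_differentiable_at n (\<lambda>y. deriv f (g y)) x"
    using assms(1,2) times_differentiable_at_mono[OF assms(2), of n]
    by (intro times_differentiable_at_comp[of n "deriv f" g]) (simp_all add: times_differentiable_at_Suc)
  moreover have "vanishes_to_order 1 (\<lambda>y. deriv f (g y)) x"
    using assms(3) by (simp add: vanishes_to_order_Suc)
  ultimately have "vanishes_to_order (Suc n) (\<lambda>y. deriv f (g y) * deriv g y) x"
    using assms(2,4) by (intro vanishes_to_order_mult) (auto simp: times_differentiable_at_Suc)
  with eq show ?thesis
    by (rule vanishes_to_order_cong)
qed

section \<open>Iterates of a function at a fixed point with zero derivative\<close>

lemma iterate_fixed_point_vanishing_deriv:
  assumes "times_differentiable_at n f x" "f x = x" "deriv f x = 0" "1 \<le> i" "i \<le> n"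
  shows "(f ^^ i) x = x \<and> times_differentiable_at n (f ^^ i) x \<and>
         vanishes_to_order i (deriv (f ^^ i)) x"
  using assms(4,5)
proof (induction i rule: nat_induct_at_least)
  case base
  then show ?case
    using assms by (simp add: vanishes_to_order_Suc)
next
  case (Suc i)
  \<comment> \<open>The differentiability order stays at \<open>n\<close> throughout the induction,
    and \<open>Suc i \<le> n\<close> leaves enough of it for one more composition.\<close>
  have "times_differentiable_at (Suc i) (f ^^ i) x" "times_differentiable_at (Suc i) f x"
    using Suc assms(1) by (auto elim: times_differentiable_at_mono)
  then have "vanishes_to_order (Suc i) (deriv (\<lambda>y. f ((f ^^ i) y))) x"
    using Suc assms(2,3) by (intro vanishes_to_order_deriv_comp) auto
  moreover have "times_differentiable_at n (\<lambda>y. f ((f ^^ i) y)) x"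
    using Suc assms(1) by (intro times_differentiable_at_comp[of n f "f ^^ i"]) auto
  ultimately show ?case
    using Suc assms(2) by (simp add: o_def)
qed

text \<open>Being an accelerator promises just one derivative of \<open>h u\<close> at
  \<open>x\<close>, while the conclusion concerns derivatives up to order \<open>k\<close>. The
  assumed order \<open>m - 1\<close> is the largest admissible \<open>k\<close>.\<close>

theorem proposition2:
  fixes m :: nat and x :: real and h :: "(real \<Rightarrow> real) \<Rightarrow> (real \<Rightarrow> real)"
  assumes "m \<ge> 1"
    and "accelerator_of_set x (NEU m x) h"
    and "\<forall>u\<in>NEU m x. times_differentiable_at (m - 1) (h u) x"
  shows "\<forall>k. 1 \<le> k \<and> k < m \<longrightarrow>
           at_least_k_accelerator_of_set k x (NEU m x) (\<lambda>u. h u ^^ k)"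
proof (intro allI impI)
  fix k
  assume k: "1 \<le> k \<and> k < m"
  show "at_least_k_accelerator_of_set k x (NEU m x) (\<lambda>u. h u ^^ k)"
    unfolding at_least_k_accelerator_of_set_def
  proof
    fix u
    assume u: "u \<in> NEU m x"
    then have acc: "u x = x" "h u x = x" "deriv (h u) x = 0"
      using assms(2) by (auto simp: accelerator_of_set_def accelerator_def DERIV_imp_deriv)
    have "times_differentiable_at k (h u) x"
      using assms(3) u k times_differentiable_at_mono[of "m - 1" "h u" x k] by auto
    then have it: "(h u ^^ k) x = x" "times_differentiable_at k (h u ^^ k) x"
      "vanishes_to_order k (deriv (h u ^^ k)) x"
      using iterate_fixed_point_vanishing_deriv[of k "h u" x k] acc k by auto
    \<comment> \<open>Index shift: the derivative of order \<open>j \<ge> 1\<close> is the one of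
      order \<open>j - 1 < k\<close> of \<open>deriv (h u ^^ k)\<close>.\<close>
    have "(deriv ^^ j) (h u ^^ k) x = 0" if "j \<in> {1..k}" for j
      using it(3) that by (cases j) (auto simp: vanishes_to_order_def funpow_Suc_right simp del: funpow.simps)
    with acc it show "at_least_k_accelerator k x u (h u ^^ k)"
      by (simp add: at_least_k_accelerator_def)
  qed
qed

end
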